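(* Let $K$ be a proper cone (closed, pointed, full-dimensional convex cone in $\mathbb{R}^n$) that admits a $\nu$-logarithmically homogeneous self-concordant barrier. Then $\mathrm{sp}_K(\epsilon)\le \lceil (4\nu/\epsilon)^2\rceil$ for all $\epsilon\in(0,1)$.
   Context: A convex cone $K\subseteq\mathbb{R}^n$ is pointed if $K\cap(-K)=\{0\}$ and full-dimensional if $\mathrm{span}(K)=\mathbb{R}^n$. Sparsification function. For a closed convex cone $K$ and $x,y\in\mathrm{span}(K)$, write $x\preceq_K y$ if $y-x\in K$. A sparsification function for $K$ is a monotonically non-increasing upper semi-continuous function $\alpha:(0,1)\to\mathbb{R}$ such that for any $x_1,\dots,x_m\in K$ with $\sum_{i=1}^m x_i=e\in\mathrm{relint}(K)$ and any $0<\epsilon<1$, there exist $S\subseteq[m]$ with $|S|\le\alpha(\epsilon)$ and positive scalars $(\lambda_i)_{i\in S}$ such that $(1-\epsilon)e\preceq_K\sum_{i\in S}\lambda_i x_i\preceq_K(1+\epsilon)e$. Let $\mathcal{F}_K$ be the collection of all sparsification functions for $K$; the sparsification function of $K$ is $\mathrm{sp}_K(\epsilon)=\inf_{\alpha\in\mathcal{F}_K}\alpha(\epsilon)$, $\epsilon\in(0,1)$. Barriers. $D^kf(x)[u_1,\dots,u_k]=\frac{\partial^k}{\partial t_1\cdots\partial t_k}f(x+t_1u_1+\cdots+t_ku_k)|_{t_1=\cdots=t_k=0}$. A three-times continuously differentiable closed convex function $\phi:\mathrm{dom}(\phi)\to\mathbb{R}$ with open domain $\mathrm{dom}(\phi)\subseteq\mathbb{R}^n$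 is standard self-concordant if $|D^3\phi(x)[u,u,u]|\le 2D^2\phi(x)[u,u]^{3/2}$ for all $x\in\mathrm{dom}(\phi)$, $u\in\mathbb{R}^n$. It is a $\nu$-logarithmically homogeneous self-concordant barrier for a closed full-dimensional convex cone $K$ if in addition $\mathrm{cl}(\mathrm{dom}(\phi))=K$ and $\phi(tx)=\phi(x)-\nu\log t$ for all $x\in\mathrm{dom}(\phi)$, $t>0$. *)

theory Defs
  imports "HOL-Analysis.Analysis"
begin

definition proper_cone :: "'a::euclidean_space set \<Rightarrow> bool" where
  "proper_cone K \<longleftrightarrow>
     closed K \<and> convex_cone K \<and> K \<inter> uminus ` K = {0} \<and> span K = UNIV"

definition cone_le :: "'a::euclidean_space set \<Rightarrow> 'a \<Rightarrow> 'a \<Rightarrow> bool" where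
  "cone_le K x y \<longleftrightarrow> y - x \<in> K"

definition usc_on :: "'a::topological_space set \<Rightarrow> ('a \<Rightarrow> real) \<Rightarrow> bool" where
  "usc_on S f \<longleftrightarrow> (\<forall>x\<in>S. \<forall>c>f x. \<forall>\<^sub>F y in at x within S. f y < c)"

text \<open>Only the values of \<open>\<alpha>\<close> on the open unit interval matter.\<close>

definition sparsification_functions :: "'a::euclidean_space set \<Rightarrow> (real \<Rightarrow> real) set" where
  "sparsification_functions K =
     {\<alpha>. antimono_on {0<..<1} \<alpha> \<and> usc_on {0<..<1} \<alpha> \<and>
       (\<forall>(m::nat) (x::nat \<Rightarrow> 'a) e \<epsilon>.
          (\<forall>i\<in>{1..m}. x i \<in> K) \<and> (\<Sum>i\<in>{1..m}. x i) = e \<and> e \<in> rel_interior K \<and>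
          0 < \<epsilon> \<and> \<epsilon> < 1 \<longrightarrow>
          (\<exists>S \<subseteq> {1..m}. \<exists>l::nat \<Rightarrow> real.
             real (card S) \<le> \<alpha> \<epsilon> \<and> (\<forall>i\<in>S. 0 < l i) \<and>
             cone_le K ((1 - \<epsilon>) *\<^sub>R e) (\<Sum>i\<in>S. l i *\<^sub>R x i) \<and>
             cone_le K (\<Sum>i\<in>S. l i *\<^sub>R x i) ((1 + \<epsilon>) *\<^sub>R e)))}"

text \<open>The infimum is taken in the extended reals, so that it is \<open>\<infinity>\<close>, rather than an
  arbitrary real number, for a cone without any sparsification function.\<close>

definition sp :: "'a::euclidean_space set \<Rightarrow> real \<Rightarrow> ereal" where
  "sp K \<epsilon> = (INF \<alpha>\<in>sparsification_functions K. ereal (\<alpha> \<epsilon>))"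

text \<open>\<open>higher_deriv f [u\<^sub>1, \<dots>, u\<^sub>k] x\<close> is \<open>D\<^sup>kf(x)[u\<^sub>1, \<dots>, u\<^sub>k]\<close>: the iterated partial derivative of
  \<open>f (x + t\<^sub>1 u\<^sub>1 + \<dots> + t\<^sub>k u\<^sub>k)\<close> at \<open>t = 0\<close>, with the derivative in \<open>t\<^sub>1\<close> outermost.\<close>

primrec higher_deriv :: "('a::real_normed_vector \<Rightarrow> real) \<Rightarrow> 'a list \<Rightarrow> 'a \<Rightarrow> real" where
  "higher_deriv f [] x = f x"
| "higher_deriv f (u # us) x = deriv (\<lambda>t. higher_deriv f us (x + t *\<^sub>R u)) 0"

text \<open>\<open>k\<close> times continuously differentiable on an open set \<open>S\<close>.\<close>

fun C_diff_on :: "nat \<Rightarrow> 'a::euclidean_space set \<Rightarrow> ('a \<Rightarrow> real) \<Rightarrow> bool" where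
  "C_diff_on 0 S f \<longleftrightarrow> continuous_on S f"
| "C_diff_on (Suc k) S f \<longleftrightarrow>
     (\<forall>x\<in>S. f differentiable (at x)) \<and>
     (\<forall>u. C_diff_on k S (\<lambda>x. frechet_derivative f (at x) u))"

text \<open>A partial function is given by its domain \<open>D\<close> and a total function whose values outside
  \<open>D\<close> are irrelevant. It is a closed function if its epigraph over \<open>D\<close> is closed in the whole
  product space.\<close>

definition standard_self_concordant :: "'a::euclidean_space set \<Rightarrow> ('a \<Rightarrow> real) \<Rightarrow> bool" where
  "standard_self_concordant D \<phi> \<longleftrightarrow>
     open D \<and> C_diff_on 3 D \<phi> \<and> convex_on D \<phi> \<and> closed (epigraph D \<phi>) \<and>
     (\<forall>x\<in>D. \<forall>u. \<bar>higher_deriv \<phi> [u, u, u] x\<bar> \<le> 2 * higher_deriv \<phi> [u, u] x powr (3 / 2))"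

definition log_homogeneous_barrier ::
  "real \<Rightarrow> 'a::euclidean_space set \<Rightarrow> 'a set \<Rightarrow> ('a \<Rightarrow> real) \<Rightarrow> bool" where
  "log_homogeneous_barrier \<nu> K D \<phi> \<longleftrightarrow>
     standard_self_concordant D \<phi> \<and> closure D = K \<and>
     (\<forall>x\<in>D. \<forall>t>0. t *\<^sub>R x \<in> D \<and> \<phi> (t *\<^sub>R x) = \<phi> x - \<nu> * ln t)"

end

(* Maurey's empirical method in the local norm of the barrier. Write |u|^2 = D^2 phi(e)[u,u].
   Self-concordance gives the Dikin ellipsoid (|h| < 1 implies e + h in dom phi) and, along the
   recession directions x of K, the bound |x| <= p(x) := - D phi(e)[x]. Logarithmic homogeneity
   gives p(e) = nu. So if e = sum of x_i, then e/nu is the convex combination with weights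
   p(x_i)/nu of the points x_i/p(x_i) of norm at most 1, and some average of k of these points,
   with repetition, is within 1/sqrt k of e/nu. Multiplying by nu gives the error nu/sqrt k, which
   is less than eps for k = floor((nu/eps)^2) + 1. As |e|^2 = nu = p(e), the bound above also gives
   nu >= 1, hence k <= (4 nu/eps)^2; unlike the ceiling of this number, it is an upper
   semi-continuous function of eps. *)

theory Submission
  imports Defs
begin

section \<open>A differential inequality in one variable\<close>

text \<open>For the second derivative \<open>g\<close> of a self-concordant function along a line one would like to
  use that \<open>g powr (-1/2)\<close> is 1-Lipschitz; the shift by \<open>\<delta>\<close> allows for zeros of \<open>g\<close>.\<close>

lemma inverse_sqrt_Lipschitz:
  fixes g h :: "real \<Rightarrow> real"
  assumes deriv: "\<And>s. 0 \<le> s \<Longrightarrow> s \<le> t \<Longrightarrow> (g has_real_derivative h s) (at s)"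
    and nonneg: "\<And>s. 0 \<le> s \<Longrightarrow> s \<le> t \<Longrightarrow> 0 \<le> g s"
    and bound: "\<And>s. 0 \<le> s \<Longrightarrow> s \<le> t \<Longrightarrow> \<bar>h s\<bar> \<le> 2 * g s powr (3/2)"
    and "0 < \<delta>" "0 \<le> t"
  shows "\<bar>(g t + \<delta>) powr (-1/2) - (g 0 + \<delta>) powr (-1/2)\<bar> \<le> t"
proof -
  have "norm ((g t + \<delta>) powr (-1/2) - (g 0 + \<delta>) powr (-1/2)) \<le> 1 * norm (t - 0)"
  proof (rule field_differentiable_bound[where S = "{0..t}" and
        f' = "\<lambda>s. (-1/2) * (g s + \<delta>) powr (-3/2) * h s"])
    fix s assume s: "s \<in> {0..t}"
    have pos: "g s + \<delta> > 0"
      using nonneg[of s] s \<open>0 < \<delta>\<close> by simp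
    have "((\<lambda>s. g s + \<delta>) has_real_derivative h s) (at s)"
      using s deriv[of s] by (auto intro!: derivative_eq_intros)
    from DERIV_fun_powr[OF this pos, of "-1/2"]
    have "((\<lambda>s. (g s + \<delta>) powr (-1/2)) has_real_derivative
        (-1/2) * (g s + \<delta>) powr (-3/2) * h s) (at s)"
      by simp
    then show "((\<lambda>s. (g s + \<delta>) powr (-1/2)) has_field_derivative
        (-1/2) * (g s + \<delta>) powr (-3/2) * h s) (at s within {0..t})"
      by (auto intro: has_field_derivative_at_within)
    \<comment> \<open>The powers of \<open>g s + \<delta>\<close> cancel, and the factor 1/2 from
      differentiating cancels the 2 of self-concordance; hence the Lipschitz constant 1.\<close>
    have "\<bar>h s\<bar> \<le> 2 * (g s + \<delta>) powr (3/2)"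
      using bound[of s] powr_mono2[of "3/2" "g s" "g s + \<delta>"] nonneg[of s] s \<open>0 < \<delta>\<close> by auto
    then have "(g s + \<delta>) powr (-3/2) * \<bar>h s\<bar> \<le> (g s + \<delta>) powr (-3/2) * (2 * (g s + \<delta>) powr (3/2))"
      by (intro mult_left_mono) auto
    also have "\<dots> = 2"
      using pos by (simp flip: powr_add)
    finally show "norm ((-1/2) * (g s + \<delta>) powr (-3/2) * h s) \<le> 1"
      by (simp add: abs_mult)
  qed (use \<open>0 \<le> t\<close> in auto)
  then show ?thesis using \<open>0 \<le> t\<close> by simp
qed

section \<open>Directional derivatives as iterable operators on functions\<close>

definition dderiv :: "'a::real_normed_vector \<Rightarrow> ('a \<Rightarrow> real) \<Rightarrow> 'a \<Rightarrow> real" where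
  "dderiv u f = (\<lambda>x. frechet_derivative f (at x) u)"

definition hess :: "('a::real_normed_vector \<Rightarrow> real) \<Rightarrow> 'a \<Rightarrow> 'a \<Rightarrow> 'a \<Rightarrow> real" where
  "hess f x u v = dderiv v (dderiv u f) x"

lemma C_diff_on_Suc_dderiv:
  "C_diff_on (Suc k) S f \<longleftrightarrow>
     (\<forall>x\<in>S. f differentiable (at x)) \<and> (\<forall>u. C_diff_on k S (dderiv u f))"
  by (simp add: dderiv_def)

lemma has_derivative_dderiv:
  assumes "f differentiable (at x)"
  shows "(f has_derivative (\<lambda>u. dderiv u f x)) (at x)"
  using assms by (simp add: dderiv_def flip: frechet_derivative_works)

lemma linear_dderiv:
  assumes "f differentiable (at x)"
  shows "linear (\<lambda>u. dderiv u f x)"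
  using linear_frechet_derivative[OF assms] by (simp add: dderiv_def)

lemma has_real_derivative_line:
  assumes "f differentiable (at (x + t *\<^sub>R u))"
  shows "((\<lambda>t. f (x + t *\<^sub>R u)) has_real_derivative dderiv u f (x + t *\<^sub>R u)) (at t)"
proof -
  have "((\<lambda>t. x + t *\<^sub>R u) has_derivative (\<lambda>t. t *\<^sub>R u)) (at t)"
    by (auto intro!: derivative_eq_intros)
  from diff_chain_at[OF this has_derivative_dderiv[OF assms]]
  have "((\<lambda>t. f (x + t *\<^sub>R u)) has_derivative (\<lambda>s. dderiv (s *\<^sub>R u) f (x + t *\<^sub>R u))) (at t)"
    by (simp add: o_def)
  moreover have "(\<lambda>s. dderiv (s *\<^sub>R u) f (x + t *\<^sub>R u)) = (*) (dderiv u f (x + t *\<^sub>R u))"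
    using linear_scale[OF linear_dderiv[OF assms]] by (auto simp: mult.commute)
  ultimately show ?thesis
    by (simp add: has_field_derivative_def)
qed

lemma eventually_line_in_open:
  fixes x u :: "'a::real_normed_vector"
  assumes "open D" "x \<in> D"
  shows "\<forall>\<^sub>F t in nhds (0::real). x + t *\<^sub>R u \<in> D"
proof -
  have "open ((\<lambda>t::real. x + t *\<^sub>R u) -` D)"
    using assms(1) by (intro open_vimage continuous_intros)
  then show ?thesis
    using assms(2) by (auto simp: eventually_nhds)
qed

text \<open>Bridge from \<open>deriv\<close> along a line to \<open>dderiv\<close>: \<open>g\<close>
  and \<open>f\<close> need to agree only on \<open>D\<close>, since the line stays in the open set
  \<open>D\<close> for small \<open>t\<close>.\<close>

lemma deriv_line_cong:
  fixes x u :: "'a::real_normed_vector"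
  assumes "open D" "x \<in> D" "\<And>y. y \<in> D \<Longrightarrow> g y = f y" "f differentiable (at x)"
  shows "deriv (\<lambda>t. g (x + t *\<^sub>R u)) 0 = dderiv u f x"
proof -
  have "((\<lambda>t. f (x + t *\<^sub>R u)) has_real_derivative dderiv u f x) (at 0)"
    using has_real_derivative_line[of f x 0 u] assms(4) by simp
  moreover have "\<forall>\<^sub>F t in nhds 0. g (x + t *\<^sub>R u) = f (x + t *\<^sub>R u)"
    using eventually_line_in_open[OF assms(1,2), of u] by eventually_elim (rule assms(3))
  ultimately have "((\<lambda>t. g (x + t *\<^sub>R u)) has_real_derivative dderiv u f x) (at 0)"
    by (simp cong: DERIV_cong_ev)
  then show ?thesis by (rule DERIV_imp_deriv)
qed

section \<open>Self-concordant functions: derivatives and convexity\<close>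

locale self_concordant =
  fixes D :: "'a::euclidean_space set" and \<phi> :: "'a \<Rightarrow> real"
  assumes self_concordant: "standard_self_concordant D \<phi>"
begin

lemma open_dom: "open D"
  and C3: "C_diff_on 3 D \<phi>"
  and convex_on_dom: "convex_on D \<phi>"
  and closed_epigraph: "closed (epigraph D \<phi>)"
  using self_concordant by (auto simp: standard_self_concordant_def)

lemma differentiable:
  assumes "x \<in> D"
  shows "\<phi> differentiable (at x)"
    and "dderiv u \<phi> differentiable (at x)"
    and "dderiv v (dderiv u \<phi>) differentiable (at x)"
  using C3 assms
  by (auto simp add: numeral_3_eq_3 C_diff_on_Suc_dderiv simp del: C_diff_on.simps(2))

lemma higher_deriv_eq:
  assumes "x \<in> D"
  shows "higher_deriv \<phi> [u] x = dderiv u \<phi> x"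
    and "higher_deriv \<phi> [u, u] x = hess \<phi> x u u"
    and "higher_deriv \<phi> [u, u, u] x = dderiv u (dderiv u (dderiv u \<phi>)) x"
proof -
  \<comment> \<open>Each identity is proved on all of \<open>D\<close>, because the next one
    differentiates it.\<close>
  have 1: "higher_deriv \<phi> [u] y = dderiv u \<phi> y" if "y \<in> D" for y
    using that by (simp add: deriv_line_cong[OF open_dom] differentiable)
  have 2: "higher_deriv \<phi> [u, u] y = dderiv u (dderiv u \<phi>) y" if "y \<in> D" for y
    unfolding higher_deriv.simps(2)[of _ _ "[u]"]
    by (rule deriv_line_cong[OF open_dom that 1]) (auto simp: differentiable that)
  have 3: "higher_deriv \<phi> [u, u, u] y = dderiv u (dderiv u (dderiv u \<phi>)) y" if "y \<in> D" for y
    unfolding higher_deriv.simps(2)[of _ _ "[u, u]"]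
    by (rule deriv_line_cong[OF open_dom that 2]) (auto simp: differentiable that)
  show "higher_deriv \<phi> [u] x = dderiv u \<phi> x"
    "higher_deriv \<phi> [u, u] x = hess \<phi> x u u"
    "higher_deriv \<phi> [u, u, u] x = dderiv u (dderiv u (dderiv u \<phi>)) x"
    using 1 2 3 assms by (auto simp: hess_def)
qed

lemma third_derivative_bound:
  assumes "x \<in> D"
  shows "\<bar>dderiv u (dderiv u (dderiv u \<phi>)) x\<bar> \<le> 2 * hess \<phi> x u u powr (3/2)"
  using self_concordant assms higher_deriv_eq[OF assms]
  unfolding standard_self_concordant_def by metis

text \<open>Restriction to a line reduces this to convexity in one variable. As \<open>s\<close> and
  \<open>t\<close> come in either order, tangents can be compared in both directions.\<close>

lemma above_tangent_line:
  assumes "x + s *\<^sub>R u \<in> D" "x + t *\<^sub>R u \<in> D"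
  shows "\<phi> (x + t *\<^sub>R u) - \<phi> (x + s *\<^sub>R u) \<ge> dderiv u \<phi> (x + s *\<^sub>R u) * (t - s)"
proof -
  let ?A = "{t. x + t *\<^sub>R u \<in> D}"
  have eq: "x + (a * s + b * t) *\<^sub>R u = a *\<^sub>R (x + s *\<^sub>R u) + b *\<^sub>R (x + t *\<^sub>R u)"
    if "a + b = 1" for a b s t
    using that by (simp add: algebra_simps flip: scaleR_add_left)
  have conv: "convex_on ?A (\<lambda>t. \<phi> (x + t *\<^sub>R u))"
    using convex_on_dom by (auto simp: convex_on_def convex_def eq)
  have "open ((\<lambda>t::real. x + t *\<^sub>R u) -` D)"
    using open_dom by (intro open_vimage continuous_intros)
  then have "open ?A" by (simp add: vimage_def)
  then show ?thesis
    using assms convex_on_imp_convex[OF conv]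
    by (intro convex_on_imp_above_tangent[OF conv])
       (auto simp: interior_open convex_connected has_field_derivative_at_within
          intro!: has_field_derivative_at_within has_real_derivative_line differentiable)
qed

lemma above_tangent:
  assumes "x \<in> D" "y \<in> D"
  shows "\<phi> y \<ge> \<phi> x + dderiv (y - x) \<phi> x"
  using above_tangent_line[of x 0 "y - x" 1] assms by simp

lemma hess_nonneg:
  assumes "x \<in> D"
  shows "0 \<le> hess \<phi> x u u"
proof -
  let ?A = "{t. x + t *\<^sub>R u \<in> D}"
  have "open ((\<lambda>t::real. x + t *\<^sub>R u) -` D)"
    using open_dom by (intro open_vimage continuous_intros)
  then have "open ?A" by (simp add: vimage_def)
  moreover have "mono_on ?A (\<lambda>t. dderiv u \<phi> (x + t *\<^sub>R u))"
  proof (rule mono_onI)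
    fix s t assume st: "s \<in> ?A" "t \<in> ?A" "s \<le> t"
    \<comment> \<open>The sum of the tangent inequalities at \<open>s\<close> and at
      \<open>t\<close>, in which the values of \<open>\<phi>\<close> cancel.\<close>
    have "dderiv u \<phi> (x + s *\<^sub>R u) * (t - s) + dderiv u \<phi> (x + t *\<^sub>R u) * (s - t) \<le> 0"
      using above_tangent_line[of x s u t] above_tangent_line[of x t u s] st by simp
    then have "(dderiv u \<phi> (x + s *\<^sub>R u) - dderiv u \<phi> (x + t *\<^sub>R u)) * (t - s) \<le> 0"
      by (simp add: algebra_simps)
    then show "dderiv u \<phi> (x + s *\<^sub>R u) \<le> dderiv u \<phi> (x + t *\<^sub>R u)"
      using st(3) by (cases "s = t") (auto simp: mult_le_0_iff)
  qed
  ultimately show ?thesis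
    using has_real_derivative_line[of "dderiv u \<phi>" x 0 u] assms
    by (intro mono_on_imp_deriv_nonneg[where A = ?A and x = 0])
       (auto simp: interior_open hess_def differentiable)
qed

section \<open>The Dikin ellipsoid and recession directions\<close>

lemma hess_line_Lipschitz:
  assumes "0 \<le> t" "\<And>s. 0 \<le> s \<Longrightarrow> s \<le> t \<Longrightarrow> x + s *\<^sub>R u \<in> D" "0 < \<delta>"
  shows "\<bar>(hess \<phi> (x + t *\<^sub>R u) u u + \<delta>) powr (-1/2) - (hess \<phi> x u u + \<delta>) powr (-1/2)\<bar> \<le> t"
  using inverse_sqrt_Lipschitz[of t "\<lambda>s. hess \<phi> (x + s *\<^sub>R u) u u"
      "\<lambda>s. dderiv u (dderiv u (dderiv u \<phi>)) (x + s *\<^sub>R u)" \<delta>]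
    has_real_derivative_line[of "dderiv u (dderiv u \<phi>)" x _ u]
    third_derivative_bound hess_nonneg assms
  by (simp add: hess_def differentiable)

text \<open>Suppose the segment from \<open>x\<close> to \<open>x + h\<close> leaves
  \<open>D\<close>, first at time \<open>T\<close>. The Lipschitz bound keeps the second derivative
  bounded before \<open>T\<close>, hence also the first derivative and \<open>\<phi>\<close> from
  above. Closedness of the epigraph then puts the exit point into \<open>D\<close>, a
  contradiction.\<close>

lemma Dikin_ellipsoid:
  assumes x: "x \<in> D" and h: "hess \<phi> x h h < 1"
  shows "x + h \<in> D"
proof (rule ccontr)
  assume out: "x + h \<notin> D"
  define N where "N = {t::real. 0 \<le> t \<and> x + t *\<^sub>R h \<notin> D}"
  define T where "T = Inf N"
  have N_eq: "N = {0..} \<inter> (\<lambda>t. x + t *\<^sub>R h) -` (- D)"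
    by (auto simp: N_def)
  have "closed ((\<lambda>t::real. x + t *\<^sub>R h) -` (- D))"
    using open_dom by (intro closed_vimage continuous_intros) auto
  then have "closed N"
    using closed_Int[OF closed_atLeast[of 0]] N_eq by simp
  moreover have N: "1 \<in> N" "bdd_below N"
    using out by (auto simp: N_def bdd_below_def)
  ultimately have TN: "T \<in> N"
    unfolding T_def by (intro closed_contains_Inf) auto
  have T1: "T \<le> 1" and T_le: "T \<le> t" if "t \<in> N" for t
    unfolding T_def using N that by (auto intro: cInf_lower)
  have T0: "T > 0"
    using TN x by (cases "T = 0") (auto simp: N_def)
  have seg: "x + t *\<^sub>R h \<in> D" if "0 \<le> t" "t < T" for t
    using T_le[of t] that by (force simp: N_def)
  \<comment> \<open>Small enough that the shifted Hessian value stays below 1, which makes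
    \<open>s > 1\<close>.\<close>
  define \<delta> where "\<delta> = (1 - hess \<phi> x h h) / 2"
  have \<delta>: "\<delta> > 0" "hess \<phi> x h h + \<delta> < 1" "hess \<phi> x h h + \<delta> > 0"
    using h hess_nonneg[OF x, of h] by (auto simp: \<delta>_def field_simps)
  define s where "s = (hess \<phi> x h h + \<delta>) powr (-1/2)"
  have s: "s > 1"
    using \<delta> powr_less_mono2_neg[of "-1/2" "hess \<phi> x h h + \<delta>" 1] by (simp add: s_def)
  \<comment> \<open>Before time \<open>T \<le> 1\<close> the inverse square root has dropped from
    \<open>s\<close> by less than 1, so it is still at least \<open>s - 1 > 0\<close>.\<close>
  define M where "M = (s - 1) powr (-2)"
  have M: "hess \<phi> (x + t *\<^sub>R h) h h \<le> M" if t: "0 \<le> t" "t < T" for t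
  proof -
    define w where "w = hess \<phi> (x + t *\<^sub>R h) h h + \<delta>"
    have w: "w > 0"
      using hess_nonneg[OF seg[OF t], of h] \<delta> by (simp add: w_def)
    have "\<bar>w powr (-1/2) - s\<bar> \<le> t"
      unfolding w_def s_def using t seg \<delta> by (intro hess_line_Lipschitz) auto
    moreover have "t < 1" using t T1[OF TN] by simp
    ultimately have "s - 1 \<le> w powr (-1/2)" by linarith
    then have "(w powr (-1/2)) powr (-2) \<le> M"
      unfolding M_def using s by (intro powr_mono2') auto
    then show ?thesis using w \<delta> by (simp add: powr_powr w_def)
  qed
  define C where "C = dderiv h \<phi> x + M"
  have M0: "M \<ge> 0" by (simp add: M_def)
  have C: "dderiv h \<phi> (x + t *\<^sub>R h) \<le> C" if t: "0 \<le> t" "t < T" for t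
  proof -
    have "dderiv h \<phi> (x + t *\<^sub>R h) - M * t \<le> dderiv h \<phi> (x + 0 *\<^sub>R h) - M * 0"
    proof (rule DERIV_nonpos_imp_nonincreasing[OF t(1)])
      fix r assume "0 \<le> r" "r \<le> t"
      then show "\<exists>y. ((\<lambda>r. dderiv h \<phi> (x + r *\<^sub>R h) - M * r) has_real_derivative y) (at r) \<and> y \<le> 0"
        using t M[of r] DERIV_diff[OF has_real_derivative_line[OF differentiable(2)] DERIV_cmult_Id, OF seg[of r]]
        by (intro exI[of _ "hess \<phi> (x + r *\<^sub>R h) h h - M"]) (simp add: hess_def)
    qed
    moreover have "M * t \<le> M * 1"
      using M0 t T1[OF TN] by (intro mult_left_mono) auto
    ultimately show ?thesis by (simp add: C_def)
  qed
  define B where "B = \<phi> x + \<bar>C\<bar>"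
  have B: "\<phi> (x + t *\<^sub>R h) \<le> B" if t: "0 \<le> t" "t < T" for t
  proof -
    \<comment> \<open>The tangent at time \<open>t\<close>, evaluated back at time 0, turns the
      bound on the slope into one on the value.\<close>
    have "dderiv h \<phi> (x + t *\<^sub>R h) * (0 - t) \<le> \<phi> x - \<phi> (x + t *\<^sub>R h)"
      using above_tangent_line[of x t h 0] seg[OF t] x by simp
    moreover have "dderiv h \<phi> (x + t *\<^sub>R h) * t \<le> \<bar>C\<bar> * 1"
    proof -
      have "dderiv h \<phi> (x + t *\<^sub>R h) * t \<le> \<bar>C\<bar> * t"
        using C[OF t] t by (intro mult_right_mono) auto
      also have "\<dots> \<le> \<bar>C\<bar> * 1"
        using t T1[OF TN] by (intro mult_left_mono) auto
      finally show ?thesis .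
    qed
    ultimately show ?thesis by (simp add: B_def)
  qed
  let ?P = "(\<lambda>t::real. (x + t *\<^sub>R h, B)) -` epigraph D \<phi>"
  have "closed ?P"
    using closed_epigraph by (intro closed_vimage continuous_intros)
  moreover have "{0..<T} \<subseteq> ?P"
    using seg B by (auto simp: epigraph_def)
  ultimately have "closure {0..<T} \<subseteq> ?P"
    by (intro closure_minimal)
  then have "T \<in> ?P"
    using T0 by (auto dest: subsetD[of _ _ T])
  then show False
    using TN by (auto simp: N_def epigraph_def)
qed

text \<open>Up to the shift \<open>\<delta>\<close>, the Lipschitz bound gives a second derivative
  of at least \<open>1 / (c + s)\<^sup>2\<close> at time \<open>s\<close>. Integrated over
  \<open>[0, t]\<close>, this makes the slope grow by almost \<open>1 / c\<close>, yet it must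
  remain nonpositive; so it starts at about \<open>- 1 / c\<close> or below. Letting
  \<open>t\<close> tend to infinity removes the errors.\<close>

lemma recession_direction_bound:
  assumes ray: "\<And>t. 0 \<le> t \<Longrightarrow> x + t *\<^sub>R u \<in> D"
    and decr: "\<And>t. 0 \<le> t \<Longrightarrow> dderiv u \<phi> (x + t *\<^sub>R u) \<le> 0"
  shows "sqrt (hess \<phi> x u u) \<le> - dderiv u \<phi> x"
proof -
  have x: "x \<in> D" using ray[of 0] by simp
  have bound: "sqrt (hess \<phi> x u u) \<le> - dderiv u \<phi> x + 2 / t" if t: "t > 0" for t
  proof -
    \<comment> \<open>The shift accumulates to \<open>\<delta> * t = 1 / t\<close> over the
      interval, the same size as the other error \<open>1 / (c + t) \<le> 1 / t\<close>.\<close>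
    define \<delta> where "\<delta> = 1 / t\<^sup>2"
    have \<delta>: "\<delta> > 0" using t by (simp add: \<delta>_def)
    define c where "c = (hess \<phi> x u u + \<delta>) powr (-1/2)"
    have c: "c > 0" using hess_nonneg[OF x, of u] \<delta> by (simp add: c_def)
    have low: "1 / (c + s)\<^sup>2 \<le> hess \<phi> (x + s *\<^sub>R u) u u + \<delta>" if s: "s \<ge> 0" for s
    proof -
      define w where "w = hess \<phi> (x + s *\<^sub>R u) u u + \<delta>"
      have w: "w > 0" using hess_nonneg[OF ray[OF s], of u] \<delta> by (simp add: w_def)
      have "\<bar>w powr (-1/2) - c\<bar> \<le> s"
        unfolding w_def c_def using s ray \<delta> by (intro hess_line_Lipschitz) auto
      then have "w powr (-1/2) \<le> c + s" by linarith
      then have "(c + s) powr (-2) \<le> (w powr (-1/2)) powr (-2)"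
        using w by (intro powr_mono2') auto
      then have "(c + s) powr (-2) \<le> w"
        using w by (simp add: powr_powr)
      moreover have "(c + s) powr (-2) = 1 / (c + s)\<^sup>2"
        using c s by (simp add: powr_minus powr_numeral divide_inverse)
      ultimately show ?thesis by (simp add: w_def)
    qed
    \<comment> \<open>Monotonicity of \<open>?F\<close> is the integrated form of
      \<open>low\<close>.\<close>
    let ?F = "\<lambda>s. dderiv u \<phi> (x + s *\<^sub>R u) + 1 / (c + s) + \<delta> * s"
    have "?F 0 \<le> ?F t"
    proof (rule DERIV_nonneg_imp_nondecreasing[where f = ?F, OF less_imp_le[OF t]])
      fix s assume s: "0 \<le> s" "s \<le> t"
      have "(?F has_real_derivative hess \<phi> (x + s *\<^sub>R u) u u - 1 / (c + s)\<^sup>2 + \<delta>) (at s)"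
      proof -
        have "((\<lambda>s. dderiv u \<phi> (x + s *\<^sub>R u)) has_real_derivative hess \<phi> (x + s *\<^sub>R u) u u) (at s)"
          unfolding hess_def using ray[OF s(1)]
          by (intro has_real_derivative_line differentiable)
        moreover have "((\<lambda>s. 1 / (c + s)) has_real_derivative - (1 / (c + s)\<^sup>2)) (at s)"
          using s c by (auto intro!: derivative_eq_intros simp: power2_eq_square)
        moreover have "((\<lambda>s. \<delta> * s) has_real_derivative \<delta>) (at s)"
          by (auto intro!: derivative_eq_intros)
        ultimately show ?thesis
          using DERIV_add[OF DERIV_add] by fastforce
      qed
      then show "\<exists>y. (?F has_real_derivative y) (at s) \<and> 0 \<le> y"
        using low[OF s(1)] by (intro exI conjI) auto
    qed
    moreover have "1 / (c + t) \<le> 1 / t" using c t by (simp add: frac_le)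
    moreover have "\<delta> * t = 1 / t" using t by (simp add: \<delta>_def power2_eq_square)
    moreover have "sqrt (hess \<phi> x u u) \<le> 1 / c"
    proof -
      have "c = inverse (sqrt (hess \<phi> x u u + \<delta>))"
        using hess_nonneg[OF x, of u] \<delta> powr_minus[of "hess \<phi> x u u + \<delta>" "1/2"]
        unfolding c_def by (simp add: powr_half_sqrt)
      then have "1 / c = sqrt (hess \<phi> x u u + \<delta>)"
        by (simp add: divide_inverse)
      then show ?thesis using \<delta> by simp
    qed
    moreover have "2 / t = 1 / t + 1 / t" by simp
    ultimately show ?thesis using decr[of t] t by simp
  qed
  have "((\<lambda>t. - dderiv u \<phi> x + 2 / t) \<longlongrightarrow> - dderiv u \<phi> x + 0) at_top"
    by (intro tendsto_intros tendsto_divide_0[OF tendsto_const] filterlim_at_top_imp_at_infinity filterlim_ident)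
  then have "((\<lambda>t. - dderiv u \<phi> x + 2 / t) \<longlongrightarrow> - dderiv u \<phi> x) at_top"
    by simp
  moreover have "\<forall>\<^sub>F t in at_top. sqrt (hess \<phi> x u u) \<le> - dderiv u \<phi> x + 2 / t"
    using eventually_gt_at_top[of 0] by eventually_elim (rule bound)
  ultimately show ?thesis
    by (rule tendsto_lowerbound) simp
qed

section \<open>Bilinearity of the Hessian form\<close>

lemma dderiv_eq_on_dom:
  assumes "x \<in> D" "\<And>y. y \<in> D \<Longrightarrow> f y = g y" "(g has_derivative g') (at x)"
  shows "dderiv v f x = g' v"
proof -
  have "(f has_derivative g') (at x)"
    using assms by (intro has_derivative_transform_within_open[OF assms(3) open_dom]) auto
  then show ?thesis
    using frechet_derivative_at by (fastforce simp: dderiv_def)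
qed

text \<open>Linearity of \<open>dderiv u \<phi> y\<close> in \<open>u\<close> is an identity between
  functions of \<open>y\<close> on \<open>D\<close>; differentiating it in direction
  \<open>v\<close> gives the claim.\<close>

lemma hess_linear_left:
  assumes x: "x \<in> D"
  shows "linear (\<lambda>u. hess \<phi> x u v)"
proof -
  note d = has_derivative_dderiv[OF differentiable(2)[OF x]]
  show ?thesis
  proof (rule linearI)
    fix a b
    show "hess \<phi> x (a + b) v = hess \<phi> x a v + hess \<phi> x b v"
      unfolding hess_def
      by (rule dderiv_eq_on_dom[OF x linear_add[OF linear_dderiv[OF differentiable(1)]]
            has_derivative_add[OF d d]])
  next
    fix r a
    have "dderiv (r *\<^sub>R a) \<phi> y = r * dderiv a \<phi> y" if "y \<in> D" for y
      using linear_scale[OF linear_dderiv[OF differentiable(1)[OF that]]] by simp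
    from dderiv_eq_on_dom[OF x this has_derivative_mult_right[OF d]]
    show "hess \<phi> x (r *\<^sub>R a) v = r *\<^sub>R hess \<phi> x a v"
      by (simp add: hess_def)
  qed
qed

lemma bilinear_hess:
  assumes "x \<in> D"
  shows "bilinear (hess \<phi> x)"
  using hess_linear_left[OF assms] linear_dderiv[OF differentiable(2)[OF assms]]
  by (simp add: bilinear_def hess_def)

end

section \<open>Maurey's lemma for a positive semidefinite bilinear form\<close>

text \<open>The points are chosen one at a time: the \<open>w\<close>-average over \<open>i\<close> of the squared norm of the
  current error plus \<open>y i - c\<close> exceeds that of the current error by at most 1, so some \<open>i\<close> does
  at least as well.\<close>

lemma Maurey_approximate_Caratheodory:
  fixes B :: "'a::real_vector \<Rightarrow> 'a \<Rightarrow> real" and y :: "'i \<Rightarrow> 'a" and k :: nat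
  assumes B: "bilinear B" "\<And>u. 0 \<le> B u u"
    and I: "finite I" "\<And>i. i \<in> I \<Longrightarrow> 0 \<le> w i" "sum w I = 1"
    and y: "\<And>i. i \<in> I \<Longrightarrow> B (y i) (y i) \<le> 1"
  defines "c \<equiv> (\<Sum>i\<in>I. w i *\<^sub>R y i)"
  shows "\<exists>n::'i \<Rightarrow> nat. sum n I = k \<and>
    B ((\<Sum>i\<in>I. n i *\<^sub>R y i) - k *\<^sub>R c) ((\<Sum>i\<in>I. n i *\<^sub>R y i) - k *\<^sub>R c) \<le> k"
proof (induction k)
  case 0
  show ?case
    by (intro exI[of _ "\<lambda>_. 0"]) (simp add: bilinear_lzero[OF B(1)])
next
  case (Suc k)
  have linr: "linear (B u)" and linl: "linear (\<lambda>v. B v u)" for u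
    using B(1) by (auto simp: bilinear_def)
  from Suc obtain n where n: "sum n I = k"
    "B ((\<Sum>i\<in>I. n i *\<^sub>R y i) - k *\<^sub>R c) ((\<Sum>i\<in>I. n i *\<^sub>R y i) - k *\<^sub>R c) \<le> k"
    by blast
  define z where "z = (\<Sum>i\<in>I. n i *\<^sub>R y i) - k *\<^sub>R c"
  have Bc: "(\<Sum>i\<in>I. w i * B u (y i)) = B u c" "(\<Sum>i\<in>I. w i * B (y i) u) = B c u" for u
    using linear_sum[OF linr, of u "\<lambda>i. w i *\<^sub>R y i" I] linear_sum[OF linl, of "\<lambda>i. w i *\<^sub>R y i" I u]
      linear_scale[OF linr] linear_scale[OF linl]
    by (auto simp: c_def)
  \<comment> \<open>Grouped by degree in \<open>y i\<close>: averaging replaces \<open>y i\<close>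
    by \<open>c\<close> in the linear terms, so all cross terms with \<open>z\<close>
    cancel.\<close>
  have expand: "B (z + (y i - c)) (z + (y i - c)) =
      (B z z - B z c - B c z + B c c) + (B z (y i) + B (y i) z - B c (y i) - B (y i) c)
       + B (y i) (y i)" for i
    by (simp add: bilinear_ladd[OF B(1)] bilinear_radd[OF B(1)]
        bilinear_lsub[OF B(1)] bilinear_rsub[OF B(1)])
  have "(\<Sum>i\<in>I. w i * B (z + (y i - c)) (z + (y i - c))) =
      (B z z - B z c - B c z + B c c) + (B z c + B c z - B c c - B c c)
       + (\<Sum>i\<in>I. w i * B (y i) (y i))"
    unfolding expand
    by (simp add: distrib_left right_diff_distrib sum.distrib sum_subtractf Bc I(3)
        flip: sum_distrib_right)
  also have "\<dots> = B z z - B c c + (\<Sum>i\<in>I. w i * B (y i) (y i))"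
    by simp
  also have "(\<Sum>i\<in>I. w i * B (y i) (y i)) \<le> (\<Sum>i\<in>I. w i * 1)"
    using I y by (intro sum_mono mult_left_mono) auto
  also have "\<dots> = 1" using I by simp
  finally have le: "(\<Sum>i\<in>I. w i * B (z + (y i - c)) (z + (y i - c))) \<le> k + 1"
    using n(2) B(2)[of c] by (simp add: z_def)
  have "\<exists>i\<in>I. B (z + (y i - c)) (z + (y i - c)) \<le> k + 1"
  proof (rule ccontr)
    assume "\<not> ?thesis"
    then have gt: "\<And>i. i \<in> I \<Longrightarrow> k + 1 < B (z + (y i - c)) (z + (y i - c))" by force
    \<comment> \<open>An index of positive weight makes the comparison of the averages
      strict.\<close>
    obtain j where j: "j \<in> I" "w j > 0"
      using I by (metis less_eq_real_def sum.neutral zero_neq_one)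
    have "(\<Sum>i\<in>I. w i * (k + 1)) < (\<Sum>i\<in>I. w i * B (z + (y i - c)) (z + (y i - c)))"
    proof (rule sum_strict_mono_ex1[OF I(1)])
      show "\<forall>i\<in>I. w i * (k + 1) \<le> w i * B (z + (y i - c)) (z + (y i - c))"
        by (intro ballI mult_left_mono less_imp_le[OF gt] I(2))
      show "\<exists>i\<in>I. w i * (k + 1) < w i * B (z + (y i - c)) (z + (y i - c))"
        using j gt[OF j(1)] by (intro bexI[of _ j]) auto
    qed
    then show False using le I(3) by (simp flip: sum_distrib_right)
  qed
  then obtain i where i: "i \<in> I" "B (z + (y i - c)) (z + (y i - c)) \<le> k + 1" by blast
  define n' where "n' = n(i := Suc (n i))"
  have "sum n' I = Suc k"
    using I(1) i(1) n(1) by (simp add: n'_def sum.remove[of I i])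
  moreover have "(\<Sum>i\<in>I. n' i *\<^sub>R y i) = (\<Sum>i\<in>I. n i *\<^sub>R y i) + y i"
    using I(1) i(1) by (simp add: n'_def sum.remove[of I i] algebra_simps)
  then have "(\<Sum>i\<in>I. n' i *\<^sub>R y i) - Suc k *\<^sub>R c = z + (y i - c)"
    by (simp add: z_def algebra_simps)
  ultimately show ?case using i(2) by (intro exI[of _ n']) auto
qed

section \<open>Logarithmically homogeneous barriers of proper cones\<close>

locale log_homogeneous_barrier_cone =
  fixes \<nu> :: real and K D :: "'a::euclidean_space set" and \<phi> :: "'a \<Rightarrow> real"
  assumes barrier: "log_homogeneous_barrier \<nu> K D \<phi>" and proper: "proper_cone K"

sublocale log_homogeneous_barrier_cone \<subseteq> self_concordant D \<phi>
  using barrier by unfold_locales (simp add: log_homogeneous_barrier_def)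

context log_homogeneous_barrier_cone
begin

lemma closed_cone: "closed K"
  and convex_cone: "convex_cone K"
  and pointed: "x \<in> K \<Longrightarrow> - x \<in> K \<Longrightarrow> x = 0"
  and span_cone: "span K = UNIV"
  using proper by (force simp: proper_cone_def)+

lemma closure_dom: "closure D = K"
  and scaleR_dom: "x \<in> D \<Longrightarrow> 0 < t \<Longrightarrow> t *\<^sub>R x \<in> D"
  and log_homogeneous: "x \<in> D \<Longrightarrow> 0 < t \<Longrightarrow> \<phi> (t *\<^sub>R x) = \<phi> x - \<nu> * ln t"
  using barrier by (auto simp: log_homogeneous_barrier_def)

lemma dom_subset: "x \<in> D \<Longrightarrow> x \<in> K"
  using closure_dom closure_subset by blast

lemma interior_cone: "interior K = D"
  using convex_interior_closure[of D] convex_on_imp_convex[OF convex_on_dom] open_dom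
  by (simp add: closure_dom interior_open)

text \<open>Identifies the points \<open>e\<close> allowed in a sparsification problem with those at
  which the barrier can be differentiated.\<close>

lemma rel_interior_cone: "rel_interior K = D"
proof -
  have "0 \<in> affine hull K"
    using convex_cone_contains_0[OF convex_cone] by (simp add: hull_inc)
  then have "affine hull K = UNIV"
    using affine_hull_span_0 span_cone by blast
  then show ?thesis
    by (simp add: rel_interior_interior interior_cone)
qed

text \<open>The translate of \<open>D\<close> by \<open>x\<close> is an open subset of
  \<open>K\<close>, hence lies in its interior \<open>D\<close>.\<close>

lemma dom_add_cone:
  assumes "e \<in> D" "x \<in> K"
  shows "e + x \<in> D"
proof -
  have "(+) x ` D \<subseteq> K"
    using dom_subset convex_cone_add[OF convex_cone assms(2)] by auto
  then have "(+) x ` D \<subseteq> interior K"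
    using open_translation[OF open_dom] by (intro interior_maximal)
  then show ?thesis
    using assms(1) by (auto simp: interior_cone add.commute)
qed

text \<open>Differentiates
  \<open>\<phi> ((1 + t) *\<^sub>R x) = \<phi> x - \<nu> * ln (1 + t)\<close> in \<open>t\<close>.
  It is stated for a range of \<open>t\<close> so that \<open>hess_self\<close> can differentiate
  once more.\<close>

lemma dderiv_radial:
  assumes x: "x \<in> D" and t: "- 1 < t"
  shows "dderiv x \<phi> (x + t *\<^sub>R x) = - \<nu> / (1 + t)"
proof -
  have eq: "x + s *\<^sub>R x = (1 + s) *\<^sub>R x" for s by (simp add: algebra_simps)
  have "x + t *\<^sub>R x \<in> D"
    using scaleR_dom[OF x, of "1 + t"] t by (simp add: eq)
  then have "((\<lambda>s. \<phi> (x + s *\<^sub>R x)) has_real_derivative dderiv x \<phi> (x + t *\<^sub>R x)) (at t)"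
    by (intro has_real_derivative_line differentiable)
  moreover have "((\<lambda>s. \<phi> x - \<nu> * ln (1 + s)) has_real_derivative - \<nu> / (1 + t)) (at t)"
    using t by (auto intro!: derivative_eq_intros)
  then have "((\<lambda>s. \<phi> (x + s *\<^sub>R x)) has_real_derivative - \<nu> / (1 + t)) (at t)"
    by (rule has_field_derivative_transform_within_open[where S = "{-1<..}"])
       (use t log_homogeneous[OF x] in \<open>auto simp: eq\<close>)
  ultimately show ?thesis
    by (rule DERIV_unique)
qed

lemma dderiv_self: "x \<in> D \<Longrightarrow> dderiv x \<phi> x = - \<nu>"
  using dderiv_radial[of x 0] by simp

lemma hess_self:
  assumes x: "x \<in> D"
  shows "hess \<phi> x x x = \<nu>"
proof -
  have "((\<lambda>s. dderiv x \<phi> (x + s *\<^sub>R x)) has_real_derivative hess \<phi> x x x) (at 0)"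
    using has_real_derivative_line[of "dderiv x \<phi>" x 0 x] differentiable(2)[OF x]
    by (simp add: hess_def)
  moreover have "((\<lambda>s. - \<nu> / (1 + s)) has_real_derivative \<nu>) (at 0)"
    by (auto intro!: derivative_eq_intros)
  then have "((\<lambda>s. dderiv x \<phi> (x + s *\<^sub>R x)) has_real_derivative \<nu>) (at 0)"
    by (rule has_field_derivative_transform_within_open[where S = "{-1<..}"])
       (use dderiv_radial[OF x] in auto)
  ultimately show ?thesis
    by (rule DERIV_unique)
qed

text \<open>For \<open>z\<close> in \<open>D\<close>, the tangent at \<open>y\<close> bounds
  \<open>\<phi> (t *\<^sub>R z)\<close> from below by an affine function of \<open>t\<close> with
  slope \<open>dderiv z \<phi> y\<close>. The left side changes only logarithmically, so a positive
  slope is impossible for large \<open>t\<close>. Points of \<open>K\<close> are reached as limits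
  of points of \<open>D\<close>.\<close>

lemma dderiv_nonpos:
  assumes y: "y \<in> D" and x: "x \<in> K"
  shows "dderiv x \<phi> y \<le> 0"
proof -
  note lin = linear_dderiv[OF differentiable(1)[OF y]]
  have int: "dderiv z \<phi> y \<le> 0" if z: "z \<in> D" for z
  proof -
    \<comment> \<open>The term \<open>\<nu>\<close> is \<open>- dderiv y \<phi> y\<close>, from the
      base point of the tangent.\<close>
    define c where "c = \<phi> y + \<nu> - \<phi> z"
    have le: "dderiv z \<phi> y + \<nu> * (ln t / t) + c / t \<le> 0" if t: "t > 0" for t
    proof -
      have "\<phi> (t *\<^sub>R z) \<ge> \<phi> y + dderiv (t *\<^sub>R z - y) \<phi> y"
        using above_tangent[OF y scaleR_dom[OF z t]] .
      then have "t * dderiv z \<phi> y + \<nu> * ln t + c \<le> 0"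
        using log_homogeneous[OF z t] dderiv_self[OF y] linear_diff[OF lin] linear_scale[OF lin]
        by (simp add: c_def)
      then have "(t * dderiv z \<phi> y + \<nu> * ln t + c) / t \<le> 0"
        using t by (simp add: divide_le_0_iff)
      then show ?thesis
        using t by (simp add: add_divide_distrib)
    qed
    have "((\<lambda>t. dderiv z \<phi> y + \<nu> * (ln t / t) + c / t) \<longlongrightarrow> dderiv z \<phi> y + \<nu> * 0 + 0) at_top"
      by (intro tendsto_intros ln_x_over_x_tendsto_0 tendsto_divide_0[OF tendsto_const]
          filterlim_at_top_imp_at_infinity filterlim_ident)
    then have "((\<lambda>t. dderiv z \<phi> y + \<nu> * (ln t / t) + c / t) \<longlongrightarrow> dderiv z \<phi> y) at_top"
      by simp
    moreover have "\<forall>\<^sub>F t in at_top. dderiv z \<phi> y + \<nu> * (ln t / t) + c / t \<le> 0"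
      using eventually_gt_at_top[of 0] by eventually_elim (rule le)
    ultimately show ?thesis
      by (rule tendsto_upperbound) simp
  qed
  \<comment> \<open>The interior case applied to \<open>s *\<^sub>R y + x\<close>; the summand
    \<open>s *\<^sub>R y\<close> contributes \<open>- s * \<nu>\<close>.\<close>
  have le: "dderiv x \<phi> y \<le> s * \<nu>" if "s > 0" for s
    using int[OF dom_add_cone[OF scaleR_dom[OF y that] x]] dderiv_self[OF y]
      linear_add[OF lin] linear_scale[OF lin] by simp
  have "((\<lambda>s. s * \<nu>) \<longlongrightarrow> 0 * \<nu>) (at_right 0)"
    by (intro tendsto_intros)
  then have "((\<lambda>s. s * \<nu>) \<longlongrightarrow> 0) (at_right 0)" by simp
  moreover have "\<forall>\<^sub>F s in at_right 0. dderiv x \<phi> y \<le> s * \<nu>"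
    using eventually_at_right_less[of 0] by eventually_elim (rule le)
  ultimately show ?thesis
    by (rule tendsto_lowerbound) simp
qed

lemma local_norm_bound:
  assumes "e \<in> D" "x \<in> K"
  shows "sqrt (hess \<phi> e x x) \<le> - dderiv x \<phi> e"
proof (rule recession_direction_bound)
  fix t :: real assume "0 \<le> t"
  then show "e + t *\<^sub>R x \<in> D"
    using assms by (intro dom_add_cone convex_cone_scaleR convex_cone)
  then show "dderiv x \<phi> (e + t *\<^sub>R x) \<le> 0"
    using assms(2) by (intro dderiv_nonpos)
qed

text \<open>A null direction \<open>v\<close> stays null under scaling, so the Dikin ellipsoid
  contains the whole line through \<open>e\<close> along \<open>v\<close>. Rescaling towards the
  origin puts \<open>v\<close> into the closed cone \<open>K\<close>, and likewise
  \<open>- v\<close>; pointedness concludes.\<close>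

lemma hess_definite:
  assumes e: "e \<in> D" and u: "hess \<phi> e u u = 0"
  shows "u = 0"
proof -
  have *: "v \<in> K" if v: "hess \<phi> e v v = 0" for v
  proof -
    have "s *\<^sub>R e + v \<in> K" if s: "s > 0" for s
    proof -
      have "e + (1/s) *\<^sub>R v \<in> D"
        using v bilinear_lmul[OF bilinear_hess[OF e]] bilinear_rmul[OF bilinear_hess[OF e]]
        by (intro Dikin_ellipsoid e) simp
      then have "s *\<^sub>R (e + (1/s) *\<^sub>R v) \<in> K"
        using s by (intro dom_subset scaleR_dom)
      then show ?thesis using s by (simp add: scaleR_add_right)
    qed
    then have "\<forall>\<^sub>F s in at_right 0. s *\<^sub>R e + v \<in> K"
      by (auto intro: eventually_mono[OF eventually_at_right_less])
    moreover have "((\<lambda>s::real. s *\<^sub>R e + v) \<longlongrightarrow> 0 *\<^sub>R e + v) (at_right 0)"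
      by (intro tendsto_intros)
    ultimately show ?thesis
      using Lim_in_closed_set[OF closed_cone, of "\<lambda>s. s *\<^sub>R e + v" "at_right 0"] by simp
  qed
  moreover have "hess \<phi> e (- u) (- u) = 0"
    using u bilinear_lneg[OF bilinear_hess[OF e]] bilinear_rneg[OF bilinear_hess[OF e]] by simp
  ultimately show ?thesis
    using u pointed by blast
qed

text \<open>Otherwise a ball around 0 lies in \<open>D\<close>, and scaling puts both signs of a
  basis vector into the pointed cone \<open>K\<close>.\<close>

lemma zero_notin_dom: "0 \<notin> D"
proof
  assume 0: "0 \<in> D"
  obtain r where r: "r > 0" "cball 0 r \<subseteq> D"
    using open_dom 0 open_contains_cball by blast
  have "b \<in> K \<and> - b \<in> K" if "b \<in> Basis" for b
  proof -
    have "r *\<^sub>R b \<in> D" "r *\<^sub>R (- b) \<in> D"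
      using r that by (auto intro!: subsetD[OF r(2)])
    then have "(1 / r) *\<^sub>R r *\<^sub>R b \<in> K" "(1 / r) *\<^sub>R r *\<^sub>R (- b) \<in> K"
      using r(1) scaleR_dom[of _ "1 / r"] dom_subset zero_less_divide_1_iff by blast+
    then show ?thesis using r(1) by simp
  qed
  then show False
    using pointed nonempty_Basis by (metis ex_in_conv nonzero_Basis)
qed

text \<open>At \<open>x = e\<close>, \<open>local_norm_bound\<close> reads
  \<open>sqrt \<nu> \<le> \<nu>\<close>, which leaves \<open>\<nu> = 0\<close> or
  \<open>\<nu> \<ge> 1\<close>; definiteness excludes the former because \<open>e\<close> is
  nonzero.\<close>

lemma parameter_ge_1:
  assumes e: "e \<in> D"
  shows "1 \<le> \<nu>"
proof -
  have "\<nu> \<noteq> 0"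
    using hess_definite[OF e, of e] hess_self[OF e] e zero_notin_dom by auto
  moreover have "sqrt \<nu> \<le> \<nu>"
    using local_norm_bound[OF e dom_subset[OF e]] hess_self[OF e] dderiv_self[OF e] by simp
  moreover have "0 \<le> \<nu>"
    using hess_nonneg[OF e, of e] hess_self[OF e] by simp
  ultimately have "0 < \<nu>" "\<nu> * 1 \<le> \<nu> * \<nu>"
    using power_mono[of "sqrt \<nu>" \<nu> 2] by (auto simp: power2_eq_square)
  then show ?thesis
    using mult_le_cancel_left_pos by blast
qed

section \<open>Sparsification by sampling in the local norm\<close>

lemma sparsification:
  fixes x :: "'i \<Rightarrow> 'a"
  assumes I: "finite I" "\<And>i. i \<in> I \<Longrightarrow> x i \<in> K" and e: "(\<Sum>i\<in>I. x i) = e" "e \<in> D"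
    and \<epsilon>: "0 < \<epsilon>"
  shows "\<exists>S\<subseteq>I. \<exists>l. real (card S) \<le> (\<nu> / \<epsilon>)\<^sup>2 + 1 \<and> (\<forall>i\<in>S. 0 < l i) \<and>
    cone_le K ((1 - \<epsilon>) *\<^sub>R e) (\<Sum>i\<in>S. l i *\<^sub>R x i) \<and>
    cone_le K (\<Sum>i\<in>S. l i *\<^sub>R x i) ((1 + \<epsilon>) *\<^sub>R e)"
proof -
  note bl = bilinear_hess[OF e(2)]
  have \<nu>: "\<nu> \<ge> 1" by (rule parameter_ge_1[OF e(2)])
  define p where "p = (\<lambda>i. - dderiv (x i) \<phi> e)"
  have p0: "p i \<ge> 0" and p: "hess \<phi> e (x i) (x i) \<le> (p i)\<^sup>2" if "i \<in> I" for i
    using dderiv_nonpos[OF e(2) I(2)[OF that]] local_norm_bound[OF e(2) I(2)[OF that]]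
      sqrt_le_D[of "hess \<phi> e (x i) (x i)" "p i"]
    by (auto simp: p_def)
  have x0: "x i = 0" if "i \<in> I" "p i = 0" for i
    using p[OF that(1)] that(2) hess_nonneg[OF e(2), of "x i"]
    by (intro hess_definite[OF e(2)]) simp
  have sum_p: "sum p I = \<nu>"
    using linear_sum[OF linear_dderiv[OF differentiable(1)[OF e(2)]], of x I]
      dderiv_self[OF e(2)] e(1) by (simp add: p_def sum_negf)
  \<comment> \<open>If \<open>p i = 0\<close>, then \<open>x i = 0\<close> by \<open>x0\<close>, and
    division by zero yields \<open>y i = 0\<close>, so \<open>py\<close> holds in this case
    too.\<close>
  define y where "y = (\<lambda>i. (1 / p i) *\<^sub>R x i)"
  define w where "w = (\<lambda>i. p i / \<nu>)"
  \<comment> \<open>The least integer strictly above \<open>(\<nu> / \<epsilon>)\<^sup>2\<close>;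
    strictness is what the open Dikin ellipsoid requires.\<close>
  define k where "k = Suc (nat \<lfloor>(\<nu> / \<epsilon>)\<^sup>2\<rfloor>)"
  have py: "p i *\<^sub>R y i = x i" if "i \<in> I" for i
    using x0[OF that] by (cases "p i = 0") (auto simp: y_def)
  have "real k = of_int \<lfloor>(\<nu> / \<epsilon>)\<^sup>2\<rfloor> + 1"
    by (simp add: k_def of_nat_nat)
  moreover have "0 < k" by (simp add: k_def)
  ultimately have k: "real k \<le> (\<nu> / \<epsilon>)\<^sup>2 + 1" "(\<nu> / \<epsilon>)\<^sup>2 < real k" "0 < real k"
    by linarith+
  have wy: "(\<Sum>i\<in>I. w i *\<^sub>R y i) = (1 / \<nu>) *\<^sub>R e"
  proof -
    have "(\<Sum>i\<in>I. w i *\<^sub>R y i) = (\<Sum>i\<in>I. (1 / \<nu>) *\<^sub>R x i)"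
      by (intro sum.cong refl) (simp add: w_def flip: py)
    then show ?thesis by (simp add: e(1) flip: scaleR_sum_right)
  qed
  have "hess \<phi> e (y i) (y i) \<le> 1" if "i \<in> I" for i
    using p[OF that] p0[OF that]
    by (cases "p i = 0")
       (auto simp: y_def bilinear_lmul[OF bl] bilinear_rmul[OF bl] bilinear_lzero[OF bl] field_simps power2_eq_square)
  then obtain n :: "'i \<Rightarrow> nat" where n: "sum n I = k"
    "hess \<phi> e ((\<Sum>i\<in>I. n i *\<^sub>R y i) - k *\<^sub>R (1 / \<nu>) *\<^sub>R e)
      ((\<Sum>i\<in>I. n i *\<^sub>R y i) - k *\<^sub>R (1 / \<nu>) *\<^sub>R e) \<le> k"
    using Maurey_approximate_Caratheodory[OF bl hess_nonneg[OF e(2)] I(1), of w y k] p0 \<nu> sum_p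
    by (auto simp: w_def wy[unfolded w_def] simp flip: sum_divide_distrib)
  \<comment> \<open>The drawn indices of nonzero \<open>x i\<close>; each uses up at least one of
    the \<open>k\<close> draws.\<close>
  define S where "S = {i \<in> I. 0 < n i \<and> 0 < p i}"
  \<comment> \<open>The factor \<open>\<nu> / k\<close> rescales the sum of the draws to approximate
    \<open>e\<close>, and \<open>1 / p i\<close> converts \<open>y i\<close> back to
    \<open>x i\<close>.\<close>
  define l where "l = (\<lambda>i. \<nu> * n i / (k * p i))"
  define h where "h = (\<Sum>i\<in>S. l i *\<^sub>R x i) - e"
  have S: "S \<subseteq> I" "finite S" using I(1) by (auto simp: S_def)
  have "card S = (\<Sum>i\<in>S. 1)" by simp
  also have "\<dots> \<le> sum n S" by (intro sum_mono) (auto simp: S_def)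
  also have "\<dots> \<le> k" unfolding n(1)[symmetric] using S I(1) by (intro sum_mono2) auto
  finally have card: "card S \<le> k" .
  have l: "0 < l i" if "i \<in> S" for i
    using that \<nu> k by (auto simp: l_def S_def)
  have "(\<Sum>i\<in>S. l i *\<^sub>R x i) = (\<Sum>i\<in>I. (\<nu> / k) *\<^sub>R n i *\<^sub>R y i)"
  proof (rule sum.mono_neutral_cong_left[OF I(1) S(1)])
    show "\<forall>i\<in>I - S. (\<nu> / k) *\<^sub>R n i *\<^sub>R y i = 0"
      using p0 x0 by (force simp: S_def y_def)
    show "l i *\<^sub>R x i = (\<nu> / k) *\<^sub>R n i *\<^sub>R y i" if "i \<in> S" for i
      by (simp add: l_def y_def)
  qed
  then have h: "h = (\<nu> / k) *\<^sub>R ((\<Sum>i\<in>I. n i *\<^sub>R y i) - k *\<^sub>R (1 / \<nu>) *\<^sub>R e)"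
    using k(3) \<nu> by (simp add: h_def scaleR_diff_right scaleR_sum_right)
  have "hess \<phi> e h h \<le> (\<nu> / k) * ((\<nu> / k) * k)"
    unfolding h bilinear_lmul[OF bl] bilinear_rmul[OF bl] real_scaleR_def
    using n(2) \<nu> by (intro mult_left_mono) auto
  also have "\<dots> = \<nu>\<^sup>2 / k"
    using k(3) by (simp add: power2_eq_square)
  also have "\<dots> < \<epsilon>\<^sup>2"
    using k(2,3) \<epsilon> by (simp add: power_divide field_simps)
  finally have hh: "hess \<phi> e h h < \<epsilon>\<^sup>2" .
  \<comment> \<open>The two signs of \<open>s\<close> yield the two cone inequalities after
    multiplication by \<open>\<epsilon>\<close>.\<close>
  have "e + s *\<^sub>R h \<in> D" if "\<bar>s\<bar> = 1 / \<epsilon>" for s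
  proof (rule Dikin_ellipsoid[OF e(2)])
    have "hess \<phi> e (s *\<^sub>R h) (s *\<^sub>R h) = \<bar>s\<bar>\<^sup>2 * hess \<phi> e h h"
      by (simp add: bilinear_lmul[OF bl] bilinear_rmul[OF bl] power2_eq_square)
    also have "\<dots> < 1"
      using hh \<epsilon> by (simp add: that power_divide)
    finally show "hess \<phi> e (s *\<^sub>R h) (s *\<^sub>R h) < 1" .
  qed
  then have "\<epsilon> *\<^sub>R (e + s *\<^sub>R h) \<in> K" if "\<bar>s\<bar> = 1 / \<epsilon>" for s
    using that \<epsilon> by (intro dom_subset scaleR_dom)
  from this[of "1 / \<epsilon>"] this[of "- (1 / \<epsilon>)"] have "\<epsilon> *\<^sub>R e + h \<in> K" "\<epsilon> *\<^sub>R e - h \<in> K"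
    using \<epsilon> by (auto simp: scaleR_add_right scaleR_diff_right)
  then have "cone_le K ((1 - \<epsilon>) *\<^sub>R e) (\<Sum>i\<in>S. l i *\<^sub>R x i)"
    "cone_le K (\<Sum>i\<in>S. l i *\<^sub>R x i) ((1 + \<epsilon>) *\<^sub>R e)"
    by (auto simp: cone_le_def h_def algebra_simps)
  moreover have "real (card S) \<le> (\<nu> / \<epsilon>)\<^sup>2 + 1"
    using card k(1) by linarith
  ultimately show ?thesis
    using S(1) l by blast
qed

lemma sparsification_function_power2:
  "(\<lambda>\<epsilon>. (4 * \<nu> / \<epsilon>)\<^sup>2) \<in> sparsification_functions K"
  unfolding sparsification_functions_def mem_Collect_eq
proof (intro conjI allI impI)
  show "antimono_on {0<..<1} (\<lambda>\<epsilon>. (4 * \<nu> / \<epsilon>)\<^sup>2)"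
    by (rule monotone_onI) (auto simp: power_divide intro!: divide_left_mono power_mono)
  show "usc_on {0<..<1} (\<lambda>\<epsilon>. (4 * \<nu> / \<epsilon>)\<^sup>2)"
    unfolding usc_on_def
  proof (intro ballI allI impI)
    fix \<epsilon> c :: real assume "\<epsilon> \<in> {0<..<1}" "(4 * \<nu> / \<epsilon>)\<^sup>2 < c"
    moreover have "((\<lambda>\<epsilon>. (4 * \<nu> / \<epsilon>)\<^sup>2) \<longlongrightarrow> (4 * \<nu> / \<epsilon>)\<^sup>2) (at \<epsilon> within {0<..<1})"
      using \<open>\<epsilon> \<in> {0<..<1}\<close> by (intro tendsto_intros) auto
    ultimately show "\<forall>\<^sub>F y in at \<epsilon> within {0<..<1}. (4 * \<nu> / y)\<^sup>2 < c"
      by (simp add: order_tendsto_iff)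
  qed
next
  fix m :: nat and x :: "nat \<Rightarrow> 'a" and e and \<epsilon> :: real
  assume H: "(\<forall>i\<in>{1..m}. x i \<in> K) \<and> (\<Sum>i\<in>{1..m}. x i) = e \<and> e \<in> rel_interior K \<and> 0 < \<epsilon> \<and> \<epsilon> < 1"
  then have e: "e \<in> D" by (simp add: rel_interior_cone)
  \<comment> \<open>This absorbs the \<open>+ 1\<close> left by rounding: with
    \<open>a = (\<nu> / \<epsilon>)\<^sup>2 \<ge> 1\<close>, one has
    \<open>a + 1 \<le> 16 * a\<close>.\<close>
  have "1 \<le> \<nu> / \<epsilon>" using parameter_ge_1[OF e] H by simp
  then have "1 \<le> (\<nu> / \<epsilon>)\<^sup>2" by (rule one_le_power)
  then have "(\<nu> / \<epsilon>)\<^sup>2 + 1 \<le> (4 * \<nu> / \<epsilon>)\<^sup>2" by (simp add: power_divide power_mult_distrib)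
  moreover have "\<exists>S\<subseteq>{1..m}. \<exists>l. real (card S) \<le> (\<nu> / \<epsilon>)\<^sup>2 + 1 \<and> (\<forall>i\<in>S. 0 < l i) \<and>
    cone_le K ((1 - \<epsilon>) *\<^sub>R e) (\<Sum>i\<in>S. l i *\<^sub>R x i) \<and>
    cone_le K (\<Sum>i\<in>S. l i *\<^sub>R x i) ((1 + \<epsilon>) *\<^sub>R e)"
    using H e by (intro sparsification) auto
  ultimately show "\<exists>S\<subseteq>{1..m}. \<exists>l. real (card S) \<le> (4 * \<nu> / \<epsilon>)\<^sup>2 \<and> (\<forall>i\<in>S. 0 < l i) \<and>
    cone_le K ((1 - \<epsilon>) *\<^sub>R e) (\<Sum>i\<in>S. l i *\<^sub>R x i) \<and>
    cone_le K (\<Sum>i\<in>S. l i *\<^sub>R x i) ((1 + \<epsilon>) *\<^sub>R e)"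
    by (meson order_trans)
qed

end

theorem theorem1p4:
  fixes K :: "(real ^ 'n) set" and \<nu> :: real
  assumes "proper_cone K"
    and "\<exists>D \<phi>. log_homogeneous_barrier \<nu> K D \<phi>"
  shows "\<forall>\<epsilon>\<in>{0<..<1}. sp K \<epsilon> \<le> ereal (of_int \<lceil>(4 * \<nu> / \<epsilon>)\<^sup>2\<rceil>)"
proof
  fix \<epsilon> :: real
  obtain D \<phi> where "log_homogeneous_barrier \<nu> K D \<phi>"
    using assms(2) by blast
  with assms(1) interpret log_homogeneous_barrier_cone \<nu> K D \<phi>
    by unfold_locales
  have "sp K \<epsilon> \<le> ereal ((4 * \<nu> / \<epsilon>)\<^sup>2)"
    unfolding sp_def by (rule INF_lower[OF sparsification_function_power2])
  also have "\<dots> \<le> ereal (of_int \<lceil>(4 * \<nu> / \<epsilon>)\<^sup>2\<rceil>)"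
    by simp
  finally show "sp K \<epsilon> \<le> ereal (of_int \<lceil>(4 * \<nu> / \<epsilon>)\<^sup>2\<rceil>)" .
qed

end
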